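(* Let $n,c$ be positive integers, let $\mathbb{Y}\subset\mathbb{C}^n$ be an affine variety given by the zero locus of an ideal $Z_{\mathbb{Y}}\subsetneq\mathbb{C}[x_1,\dots,x_n]$, and let $V$ and $W$ be complex vector spaces of dimensions $c$ and $1$, respectively. There exists a set-theoretical bijection between the quotient space $\mathcal{M}_{\mathbb{Y}}(c):=\mathcal{V}_{\mathbb{Y}}(c)^{st}/GL(V)$ and the Hilbert scheme $\mathrm{Hilb}^{[c]}(\mathbb{Y})$ of $c$ points in $\mathbb{Y}$.
   Context: $\mathcal{V}(n,c)$ is the set of tuples $(B_0,\dots,B_{n-1},I)\in\mathrm{End}(V)^{\oplus n}\oplus\mathrm{Hom}(W,V)$ with $[B_i,B_j]=0$ for all $i\ne j$. Such a tuple is stable if there is no proper subspace $S\subsetneq V$ with $B_0(S),\dots,B_{n-1}(S),I(W)\subset S$, and $\mathcal{V}(n,c)^{st}$ is the set of stable tuples in $\mathcal{V}(n,c)$. Define $$\mathcal{V}_{\mathbb{Y}}(c)^{st}:=\{(B_0,\dots,B_{n-1},I)\in\mathcal{V}(n,c)^{st}\mid f(B_0,\dots,B_{n-1})=0\ \ \forall f\in Z_{\mathbb{Y}}\},$$ where $x_{i+1}$ is evaluated at $B_i$. The group $GL(V)$ acts by $g\cdot(B_0,\dots,B_{n-1},I)=(gB_0g^{-1},\dots,gB_{n-1}g^{-1},gI)$. The affine coordinate ring of $\mathbb{Y}$ is $A(\mathbb{Y})=\mathbb{C}[x_1,\dots,x_n]/Z_{\mathbb{Y}}$. The Hilbert scheme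 $\mathrm{Hilb}^{[c]}(\mathbb{Y})$ parametrizes $0$-dimensional subschemes of $\mathbb{Y}$ of length $c$; as a set, it is the set of ideals $J\subset A(\mathbb{Y})$ with $\dim_{\mathbb{C}}A(\mathbb{Y})/J=c$. *)

theory Defs
  imports
    Complex_Main
    "HOL-Library.Poly_Mapping"
    "HOL-Analysis.Finite_Cartesian_Product"
    "HOL-Algebra.Algebraic_Closure_Type"
    "HOL-Algebra.Embedded_Algebras"
    "HOL-Algebra.Group_Action"
    "HOL-Algebra.QuotRing"
begin

text \<open>
  The variables \<open>x\<^sub>1, \<dots>, x\<^sub>n\<close> are indexed by a finite type \<open>'n\<close> with \<open>n = CARD('n)\<close>; types are
  nonempty, so \<open>n \<ge> 1\<close>. A polynomial maps each exponent vector \<open>'n \<Rightarrow>\<^sub>0 nat\<close> to its coefficient;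
  multiplication of \<open>Poly_Mapping\<close> is the convolution product, i.e. that of
  \<open>\<complex>[x\<^sub>1, \<dots>, x\<^sub>n]\<close>.
\<close>

type_synonym 'n cpoly = "('n \<Rightarrow>\<^sub>0 nat) \<Rightarrow>\<^sub>0 complex"

abbreviation cpoly_ring :: "'n cpoly ring"
  where "cpoly_ring \<equiv> ring_of_type_algebra"

definition eval_point :: "'n::finite cpoly \<Rightarrow> complex ^ 'n \<Rightarrow> complex"
  where "eval_point f p = (\<Sum>m\<in>Poly_Mapping.keys f.
    Poly_Mapping.lookup f m * (\<Prod>i\<in>UNIV. (p $ i) ^ Poly_Mapping.lookup m i))"

definition zero_locus :: "'n::finite cpoly set \<Rightarrow> (complex ^ 'n) set"
  where "zero_locus Z = {p. \<forall>f\<in>Z. eval_point f p = 0}"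


subsection \<open>Evaluating polynomials at commuting endomorphisms\<close>

text \<open>
  Composition of endomorphisms is not commutative, so \<open>\<Prod>\<close> is unavailable. The fold is independent
  of the order of the indices when the \<open>B i\<close> commute pairwise, and it is used only for such \<open>B\<close>.
\<close>

definition op_monom :: "('n::finite \<Rightarrow> 'v \<Rightarrow> 'v) \<Rightarrow> ('n \<Rightarrow>\<^sub>0 nat) \<Rightarrow> 'v \<Rightarrow> 'v"
  where "op_monom B m = Finite_Set.fold (\<lambda>i g. (B i ^^ Poly_Mapping.lookup m i) \<circ> g) id UNIV"

definition op_eval ::
  "(complex \<Rightarrow> 'v::ab_group_add \<Rightarrow> 'v) \<Rightarrow> 'n::finite cpoly \<Rightarrow> ('n \<Rightarrow> 'v \<Rightarrow> 'v) \<Rightarrow> 'v \<Rightarrow> 'v"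
  where "op_eval sV f B = (\<lambda>v. \<Sum>m\<in>Poly_Mapping.keys f.
    sV (Poly_Mapping.lookup f m) (op_monom B m v))"


subsection \<open>Stable tuples and the quotient by \<open>GL(V)\<close>\<close>

text \<open>
  \<open>sV\<close> and \<open>sW\<close> are the scalar multiplications of \<open>V = UNIV :: 'v set\<close> and
  \<open>W = UNIV :: 'w set\<close>.
\<close>

definition commuting_tuples ::
  "(complex \<Rightarrow> 'v::ab_group_add \<Rightarrow> 'v) \<Rightarrow> (complex \<Rightarrow> 'w::ab_group_add \<Rightarrow> 'w)
    \<Rightarrow> (('n::finite \<Rightarrow> 'v \<Rightarrow> 'v) \<times> ('w \<Rightarrow> 'v)) set"
  where "commuting_tuples sV sW = {(B, I).
    (\<forall>i. Vector_Spaces.linear sV sV (B i)) \<and> Vector_Spaces.linear sW sV I \<and>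
    (\<forall>i j. i \<noteq> j \<longrightarrow> B i \<circ> B j = B j \<circ> B i)}"

definition stable ::
  "(complex \<Rightarrow> 'v::ab_group_add \<Rightarrow> 'v) \<Rightarrow> ('n::finite \<Rightarrow> 'v \<Rightarrow> 'v) \<times> ('w \<Rightarrow> 'v) \<Rightarrow> bool"
  where "stable sV = (\<lambda>(B, I).
    \<not> (\<exists>S. module.subspace sV S \<and> S \<subset> UNIV \<and> (\<forall>i. B i ` S \<subseteq> S) \<and> range I \<subseteq> S))"

definition stable_tuples_on ::
  "(complex \<Rightarrow> 'v::ab_group_add \<Rightarrow> 'v) \<Rightarrow> (complex \<Rightarrow> 'w::ab_group_add \<Rightarrow> 'w)
    \<Rightarrow> 'n::finite cpoly set \<Rightarrow> (('n \<Rightarrow> 'v \<Rightarrow> 'v) \<times> ('w \<Rightarrow> 'v)) set"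
  where "stable_tuples_on sV sW Z = {(B, I) \<in> commuting_tuples sV sW.
    stable sV (B, I) \<and> (\<forall>f\<in>Z. op_eval sV f B = (\<lambda>v. 0))}"

definition GL :: "(complex \<Rightarrow> 'v::ab_group_add \<Rightarrow> 'v) \<Rightarrow> ('v \<Rightarrow> 'v) monoid"
  where "GL sV = \<lparr>carrier = {g. Vector_Spaces.linear sV sV g \<and> bij g}, monoid.mult = (\<circ>), one = id\<rparr>"

definition GL_action ::
  "('v \<Rightarrow> 'v) \<Rightarrow> ('n::finite \<Rightarrow> 'v \<Rightarrow> 'v) \<times> ('w \<Rightarrow> 'v) \<Rightarrow> ('n \<Rightarrow> 'v \<Rightarrow> 'v) \<times> ('w \<Rightarrow> 'v)"
  where "GL_action g = (\<lambda>(B, I). (\<lambda>i. g \<circ> B i \<circ> inv_into UNIV g, g \<circ> I))"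

definition moduli_space ::
  "(complex \<Rightarrow> 'v::ab_group_add \<Rightarrow> 'v) \<Rightarrow> (complex \<Rightarrow> 'w::ab_group_add \<Rightarrow> 'w)
    \<Rightarrow> 'n::finite cpoly set \<Rightarrow> (('n \<Rightarrow> 'v \<Rightarrow> 'v) \<times> ('w \<Rightarrow> 'v)) set set"
  where "moduli_space sV sW Z = orbits (GL sV) (stable_tuples_on sV sW Z) GL_action"


subsection \<open>The Hilbert scheme of points, as a set\<close>

definition coord_ring :: "'n::finite cpoly set \<Rightarrow> 'n cpoly set ring"
  where "coord_ring Z = cpoly_ring Quot Z"

text \<open>
  The image of \<open>\<complex>\<close> in \<open>A(Y)/J\<close>. The library measures dimension over a subfield of the ring;
  this image is one, isomorphic to \<open>\<complex>\<close>, whenever \<open>A(Y)/J\<close> is nonzero. For \<open>A(Y)/J = 0\<close>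
  it is \<open>{0}\<close> and the only dimension is \<open>0\<close>.
\<close>

definition quot_constants :: "'n::finite cpoly set \<Rightarrow> 'n cpoly set set \<Rightarrow> 'n cpoly set set set"
  where "quot_constants Z J =
    range (\<lambda>a. J +>\<^bsub>coord_ring Z\<^esub> (Z +>\<^bsub>cpoly_ring\<^esub> Poly_Mapping.single 0 a))"

definition Hilb :: "nat \<Rightarrow> 'n::finite cpoly set \<Rightarrow> 'n cpoly set set set"
  where "Hilb c Z = {J. ideal J (coord_ring Z) \<and>
    ring.dimension (coord_ring Z Quot J) c (quot_constants Z J) (carrier (coord_ring Z Quot J))}"

end

theory Submission
  imports Defs
begin

text \<open>
  A stable tuple \<open>(B, I)\<close> is the same thing as a presentation of \<open>V\<close> as a quotient of the polynomial
  ring. Fix a spanning vector \<open>w0\<close> of the line \<open>W\<close> and send \<open>f\<close> to \<open>f(B) (I w0)\<close>. This map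
  \<open>presentation (B, I)\<close> from \<open>\<complex>[x\<^sub>1, \<dots>, x\<^sub>n]\<close> to \<open>V\<close> is linear and turns multiplication by \<open>x\<^sub>i\<close> into \<open>B i\<close>.
  Its image is the smallest \<open>B\<close>-invariant subspace that contains the range of \<open>I\<close>, so stability means
  that it is surjective (\<open>presentation_surj\<close>, \<open>surj_presentation_imp_stable\<close>). Its kernel
  \<open>relations (B, I)\<close> is an ideal, and the equations \<open>f(B) = 0\<close> for \<open>f\<close> in \<open>Z\<close> say that the kernel contains
  \<open>Z\<close> (\<open>stable_tuples_on_iff\<close>).

  The kernel determines the orbit: two surjections onto \<open>V\<close> with the same kernel differ by a unique
  automorphism of \<open>V\<close>, and this automorphism carries one tuple to the other
  (\<open>same_relations_imp_GL_action\<close>). Conversely, a linear surjection onto \<open>V\<close> whose kernel is an ideal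
  comes from a tuple, because multiplication by \<open>x\<^sub>i\<close> descends to \<open>V\<close>
  (\<open>exists_tuple_with_presentation\<close>). Hence the moduli space is in bijection with the ideals \<open>N\<close> that
  contain \<open>Z\<close> and are kernels of linear surjections onto \<open>V\<close> (\<open>bij_betw_moduli_space_ideals\<close>).

  The ideals \<open>N\<close> containing \<open>Z\<close> correspond to the ideals \<open>J\<close> of the coordinate ring. The quotients
  \<open>\<complex>[x\<^sub>1, \<dots>, x\<^sub>n]/N\<close> and \<open>A(Y)/J\<close> are isomorphic, so the second has dimension \<open>c\<close> exactly
  when \<open>N\<close> is the kernel of a linear surjection onto the \<open>c\<close>-dimensional space \<open>V\<close>
  (\<open>dimension_coord_ring_quotient_iff\<close>).
\<close>


section \<open>Polynomials as a complex vector space\<close>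

lemma poly_mapping_single_induct [case_names zero single add]:
  assumes "P 0" and "\<And>m a. P (Poly_Mapping.single m a)"
    and "\<And>f g. P f \<Longrightarrow> P g \<Longrightarrow> P (f + g)"
  shows "P (f :: 'a \<Rightarrow>\<^sub>0 'b::monoid_add)"
proof (induction f rule: update_induct)
  case const
  show ?case by (fact assms(1))
next
  case (update f a b)
  have "Poly_Mapping.update a b f = f + Poly_Mapping.single a b"
    using update.hyps(1)
    by (intro poly_mapping_eqI) (auto simp: lookup_update lookup_add lookup_single in_keys_iff)
  then show ?case
    using assms(2,3) update.IH by metis
qed

lemma monomial_induct [case_names zero var]:
  assumes "P 0" and "\<And>i m. P m \<Longrightarrow> P (Poly_Mapping.single i 1 + m)"
  shows "P (m :: 'a \<Rightarrow>\<^sub>0 nat)"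
proof (induction m rule: update_induct)
  case const
  show ?case by (fact assms(1))
next
  case (update m i k)
  have *: "Poly_Mapping.update i k m = Poly_Mapping.single i k + m"
    using update.hyps(1)
    by (intro poly_mapping_eqI) (auto simp: lookup_update lookup_add lookup_single in_keys_iff)
  have "P (Poly_Mapping.single i l + m)" for l
  proof (induction l)
    case 0
    then show ?case using update.IH by simp
  next
    case (Suc l)
    have "Poly_Mapping.single i (Suc l) + m
        = Poly_Mapping.single i 1 + (Poly_Mapping.single i l + m)"
      by (simp add: add.assoc [symmetric] single_add [symmetric])
    then show ?case using assms(2) [OF Suc.IH] by metis
  qed
  then show ?case using * by simp
qed

lemma ring_of_type_algebra_simps:
  fixes x y :: "'a::comm_ring_1"
  shows "carrier (ring_of_type_algebra :: 'a ring) = UNIV"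
    and "x \<otimes>\<^bsub>ring_of_type_algebra\<^esub> y = x * y"
    and "x \<oplus>\<^bsub>ring_of_type_algebra\<^esub> y = x + y"
    and "\<zero>\<^bsub>ring_of_type_algebra\<^esub> = (0 :: 'a)"
    and "\<one>\<^bsub>ring_of_type_algebra\<^esub> = (1 :: 'a)"
    and "\<ominus>\<^bsub>ring_of_type_algebra\<^esub> x = - x"
proof -
  interpret R: ring "ring_of_type_algebra :: 'a ring"
    by (rule ring_from_type_algebra)
  show "\<ominus>\<^bsub>ring_of_type_algebra\<^esub> x = - x"
    by (rule R.minus_equality) (simp_all add: ring_of_type_algebra_def)
qed (simp_all add: ring_of_type_algebra_def)

definition coordinate :: "'n \<Rightarrow> 'n cpoly"
  where "coordinate i = Poly_Mapping.single (Poly_Mapping.single i 1) 1"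

definition pscale :: "complex \<Rightarrow> 'n cpoly \<Rightarrow> 'n cpoly"
  where "pscale a f = Poly_Mapping.single 0 a * f"

text \<open>
  Constants and coordinates generate the polynomial ring. Two linear maps that agree at \<open>1\<close> and
  intertwine the coordinates therefore agree everywhere.
\<close>

lemma cpoly_induct [case_names const add var]:
  fixes f :: "'n cpoly"
  assumes const: "\<And>a. P (Poly_Mapping.single 0 a)"
    and add: "\<And>f g. P f \<Longrightarrow> P g \<Longrightarrow> P (f + g)"
    and var: "\<And>i f. P f \<Longrightarrow> P (coordinate i * f)"
  shows "P f"
proof (induction f rule: poly_mapping_single_induct)
  case zero
  show ?case using const [of 0] by simp
next
  case (single m a)
  show ?case
  proof (induction m rule: monomial_induct)
    case zero
    show ?case by (fact const)
  next
    case (var i m)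
    then show ?case
      using assms(3) [OF var, of i] by (simp add: coordinate_def mult_single)
  qed
next
  case (add f g)
  then show ?case by (rule assms(2))
qed

lemma vector_space_pscale: "vector_space (pscale :: complex \<Rightarrow> 'n cpoly \<Rightarrow> 'n cpoly)"
  by unfold_locales
    (simp_all add: pscale_def distrib_left distrib_right single_add mult.assoc [symmetric] mult_single)


section \<open>Evaluation at commuting endomorphisms\<close>

locale commuting_endomorphisms = vector_space sV
  for sV :: "complex \<Rightarrow> 'v::ab_group_add \<Rightarrow> 'v" +
  fixes B :: "'n::finite \<Rightarrow> 'v \<Rightarrow> 'v"
  assumes linear_B: "\<And>i. Vector_Spaces.linear sV sV (B i)"
    and commute: "\<And>i j. B i \<circ> B j = B j \<circ> B i"
begin

sublocale B: module_hom sV sV "B i" for i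
  using linear_B module_hom_iff_linear by blast

lemma linear_funpow: "Vector_Spaces.linear sV sV (B i ^^ k)"
proof -
  have "(B i ^^ k) (v + w) = (B i ^^ k) v + (B i ^^ k) w" for v w
    by (induction k) (simp_all add: B.add)
  moreover have "(B i ^^ k) (sV a v) = sV a ((B i ^^ k) v)" for a v
    by (induction k) (simp_all add: B.scale)
  ultimately show ?thesis
    by (simp add: Vector_Spaces.linear_iff vector_space_axioms)
qed

sublocale B_pow: module_hom sV sV "B i ^^ k" for i k
  using linear_funpow module_hom_iff_linear by blast

lemma funpow_commute: "(B i ^^ k) ((B j ^^ l) v) = (B j ^^ l) ((B i ^^ k) v)"
proof -
  have 1: "B i ((B j ^^ l) v) = (B j ^^ l) (B i v)" for i j l v
    using commute [of i j] by (induction l) (simp_all add: fun_eq_iff)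
  show ?thesis
    by (induction k) (simp_all add: 1)
qed

text \<open>
  The fold in \<open>op_monom\<close> has a fixed index set; letting the set vary makes induction on it possible.
\<close>

definition partial_monom :: "('n \<Rightarrow>\<^sub>0 nat) \<Rightarrow> 'n set \<Rightarrow> 'v \<Rightarrow> 'v"
  where "partial_monom m A =
    Finite_Set.fold (\<lambda>i g. (B i ^^ Poly_Mapping.lookup m i) \<circ> g) id A"

lemma partial_monom_empty: "partial_monom m {} v = v"
  by (simp add: partial_monom_def)

lemma partial_monom_insert:
  assumes "i \<notin> A"
  shows "partial_monom m (insert i A) v = (B i ^^ Poly_Mapping.lookup m i) (partial_monom m A v)"
proof -
  interpret comp_fun_commute "\<lambda>i g. (B i ^^ Poly_Mapping.lookup m i) \<circ> g"
    by unfold_locales (simp add: fun_eq_iff funpow_commute)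
  show ?thesis
    using assms by (simp add: partial_monom_def)
qed

lemma op_monom_partial: "op_monom B m = partial_monom m UNIV"
  by (simp add: op_monom_def partial_monom_def)

lemma linear_op_monom: "Vector_Spaces.linear sV sV (op_monom B m)"
proof -
  have "Vector_Spaces.linear sV sV (partial_monom m A)" if "finite A" for A
    using that
    by (induction A)
      (simp_all add: Vector_Spaces.linear_iff vector_space_axioms partial_monom_empty partial_monom_insert
        B_pow.add B_pow.scale)
  then show ?thesis by (simp add: op_monom_partial)
qed

sublocale monom: module_hom sV sV "op_monom B m" for m
  using linear_op_monom module_hom_iff_linear by blast

text \<open>
  Here commutativity enters: the powers of \<open>B i\<close> taken from the second monomial have to move past the
  remaining factors of the first.
\<close>

lemma op_monom_add: "op_monom B (m + m') v = op_monom B m (op_monom B m' v)"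
proof -
  have comm: "(B i ^^ k) (partial_monom m A v) = partial_monom m A ((B i ^^ k) v)"
    if "finite A" for i :: 'n and k m A v
    using that
    by (induction A)
      (simp_all add: partial_monom_empty partial_monom_insert funpow_commute [where i = i and k = k])
  have "partial_monom (m + m') A v = partial_monom m A (partial_monom m' A v)"
    if "finite A" for A
    using that
    by (induction A)
      (simp_all add: partial_monom_empty partial_monom_insert lookup_add funpow_add comm)
  then show ?thesis by (simp add: op_monom_partial)
qed

lemma op_monom_zero: "op_monom B 0 v = v"
proof -
  have "partial_monom 0 A v = v" if "finite A" for A
    using that by (induction A) (simp_all add: partial_monom_empty partial_monom_insert)
  then show ?thesis by (simp add: op_monom_partial)
qed

lemma op_monom_single: "op_monom B (Poly_Mapping.single i 1) v = B i v"
proof -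
  have "partial_monom (Poly_Mapping.single i 1) A v = (if i \<in> A then B i v else v)"
    if "finite A" for A
    using that
    by (induction A) (auto simp: partial_monom_empty partial_monom_insert lookup_single when_def)
  then show ?thesis by (simp add: op_monom_partial)
qed

lemma op_eval_single: "op_eval sV (Poly_Mapping.single m a) B v = sV a (op_monom B m v)"
  by (simp add: op_eval_def)

lemma op_eval_add: "op_eval sV (f + g) B v = op_eval sV f B v + op_eval sV g B v"
  unfolding op_eval_def
  by (rule setsum_keys_plus_distrib) (simp_all add: scale_left_distrib)

lemma op_eval_const: "op_eval sV (Poly_Mapping.single 0 a) B v = sV a v"
  by (simp add: op_eval_single op_monom_zero)

lemma op_eval_var: "op_eval sV (coordinate i) B v = B i v"
  unfolding coordinate_def op_eval_single op_monom_single by simp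

lemma linear_op_eval: "Vector_Spaces.linear sV sV (op_eval sV f B)"
  by (simp add: Vector_Spaces.linear_iff vector_space_axioms op_eval_def monom.add monom.scale
      scale_right_distrib sum.distrib scale_sum_right mult.commute)

text \<open>
  Both sides are additive in \<open>f\<close> and in \<open>g\<close>, so
  that it suffices to compare them at monomials.
\<close>

lemma op_eval_mult: "op_eval sV (f * g) B v = op_eval sV f B (op_eval sV g B v)"
proof (induction f rule: poly_mapping_single_induct)
  case (single m a)
  show ?case
    by (induction g rule: poly_mapping_single_induct)
      (simp_all add: op_eval_add distrib_left op_eval_single mult_single op_monom_add monom.add
        monom.scale scale_right_distrib op_eval_def [of _ 0])
next
  case (add f g)
  then show ?case by (simp add: op_eval_add distrib_right)
qed (simp add: op_eval_def)

lemma op_eval_pscale: "op_eval sV (pscale a f) B v = sV a (op_eval sV f B v)"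
  by (simp add: pscale_def op_eval_mult op_eval_const)

end


section \<open>Dimension over the constants of a ring\<close>

text \<open>
  The basis consists of the vectors that are adjoined by the successive line extensions.
\<close>

lemma (in ring) dimension_imp_basis:
  assumes "dimension n K E"
  shows "\<exists>Us. independent K Us \<and> length Us = n \<and> Span K Us = E"
  using assms
proof induction
  case (zero_dim K)
  show ?case by (rule exI [of _ "[]"]) simp
next
  case (Suc_dim v E n K)
  then obtain Us where "independent K Us" "length Us = n" "Span K Us = E" by blast
  with Suc_dim.hyps have
    "independent K (v # Us) \<and> length (v # Us) = Suc n \<and> Span K (v # Us) = line_extension K v E"
    by (auto intro: li_Cons)
  then show ?case by (rule exI)
qed

text \<open>
  The dimension of a subset of a ring and the dimension of a vector space given by a type are unrelated
  notions. A map \<open>\<psi>\<close> that is linear along a parametrization \<open>k\<close> of the scalars of the ring transports spans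
  from one to the other and, when it is injective, also independence.
\<close>

locale semilinear_map = ring T + V: vector_space sV
  for T :: "('a, 'b) ring_scheme" (structure)
    and sV :: "complex \<Rightarrow> 'v::ab_group_add \<Rightarrow> 'v" +
  fixes k :: "complex \<Rightarrow> 'a" and \<psi> :: "'v \<Rightarrow> 'a"
  assumes k_carrier: "k a \<in> carrier T"
    and \<psi>_carrier: "\<psi> v \<in> carrier T"
    and \<psi>_add: "\<psi> (v + w) = \<psi> v \<oplus> \<psi> w"
    and \<psi>_scale: "\<psi> (sV a v) = k a \<otimes> \<psi> v"
begin

lemma \<psi>_zero: "\<psi> 0 = \<zero>"
  using \<psi>_add [of 0 0] \<psi>_carrier [of 0] by (metis add.r_cancel_one' add_0)

lemma \<psi>_eq_iff: "\<psi> v = \<psi> w \<longleftrightarrow> \<psi> (v - w) = \<zero>"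
proof -
  have "\<psi> v = \<psi> (v - w) \<oplus> \<psi> w" by (simp flip: \<psi>_add)
  then show ?thesis using \<psi>_carrier by (metis add.r_cancel_one' a_comm)
qed

text \<open>
  A line extension by \<open>\<psi> v\<close> consists of the images of the vectors \<open>a v + w\<close> with \<open>w\<close> in the old span.
\<close>

lemma Span_image: "Span (range k) (map \<psi> vs) = \<psi> ` V.span (set vs)"
proof (induction vs)
  case Nil
  then show ?case by (simp add: \<psi>_zero)
next
  case (Cons v vs)
  have "Span (range k) (map \<psi> (v # vs)) = line_extension (range k) (\<psi> v) (\<psi> ` V.span (set vs))"
    using Cons.IH by simp
  also have "\<dots> = {\<psi> (sV a v + w) | a w. w \<in> V.span (set vs)}"
    by (auto simp: line_extension_mem_iff \<psi>_add \<psi>_scale) blast+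
  also have "\<dots> = \<psi> ` V.span (insert v (set vs))"
  proof -
    have "sV a v + w \<in> V.span (insert v (set vs))" if "w \<in> V.span (set vs)" for a w
      using that by (auto simp: V.span_breakdown_eq intro!: exI [of _ a])
    moreover have "\<exists>a w. x = sV a v + w \<and> w \<in> V.span (set vs)"
      if "x \<in> V.span (insert v (set vs))" for x
    proof -
      from that obtain a where "x - sV a v \<in> V.span (set vs)"
        by (auto simp: V.span_breakdown_eq)
      moreover have "x = sV a v + (x - sV a v)" by simp
      ultimately show ?thesis by blast
    qed
    ultimately show ?thesis by blast
  qed
  finally show ?case by simp
qed

lemma independent_image:
  assumes "inj \<psi>" "distinct vs" "V.independent (set vs)"
  shows "independent (range k) (map \<psi> vs)"
  using assms(2,3)
proof (induction vs)
  case (Cons v vs)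
  then have "v \<notin> V.span (set vs)" "independent (range k) (map \<psi> vs)"
    by (auto simp: V.independent_insert split: if_splits)
  moreover from this have "\<psi> v \<notin> Span (range k) (map \<psi> vs)"
    using \<open>inj \<psi>\<close> by (simp add: Span_image inj_image_mem_iff del: Span.simps)
  ultimately show ?case
    using \<psi>_carrier by (auto intro: li_Cons)
qed simp

text \<open>
  A vector in the kernel with a nonzero coefficient at the first member of the list would express the
  image of that member by the images of the later ones.
\<close>

lemma kernel_trivial_on_span:
  assumes "independent (range k) (map \<psi> vs)" "x \<in> V.span (set vs)" "\<psi> x = \<zero>"
  shows "x = 0"
  using assms
proof (induction vs arbitrary: x)
  case (Cons v vs)
  from Cons.prems(2) obtain a where a: "x - sV a v \<in> V.span (set vs)"
    by (auto simp: V.span_breakdown_eq)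
  have ind: "\<psi> v \<notin> \<psi> ` V.span (set vs)" "independent (range k) (map \<psi> vs)"
    using Cons.prems(1) independent_backwards [of "range k" "\<psi> v" "map \<psi> vs"]
    by (simp_all add: Span_image del: Span.simps)
  show ?case
  proof (cases "a = 0")
    case True
    then show ?thesis using a Cons.IH [OF ind(2)] Cons.prems(3) by simp
  next
    case False
    let ?w = "sV (- inverse a) (x - sV a v)"
    have "v = ?w + sV (inverse a) x"
      using False by (simp add: V.scale_right_diff_distrib)
    then have "\<psi> v = \<psi> ?w \<oplus> k (inverse a) \<otimes> \<psi> x"
      by (metis \<psi>_add \<psi>_scale)
    then have "\<psi> v = \<psi> ?w"
      using Cons.prems(3) k_carrier \<psi>_carrier by simp
    moreover have "?w \<in> V.span (set vs)"
      using a by (rule V.span_scale)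
    ultimately show ?thesis using ind(1) by blast
  qed
qed simp

text \<open>
  Dimension \<open>c\<close> can be recognized without a vector space on the quotient side: if \<open>\<psi>\<close> is onto \<open>T\<close>, then
  an isomorphism \<open>T \<cong> U\<close> is the same as a linear surjection onto \<open>U\<close> with the kernel of \<open>\<psi>\<close>. In both
  directions a linear map \<open>\<sigma>\<close> from \<open>U\<close> back to \<open>V\<close> makes \<open>\<psi> \<circ> \<sigma>\<close> a bijective semilinear map from \<open>U\<close>
  to \<open>T\<close>.
\<close>

lemma dimension_iff_linear_surjection:
  fixes sU :: "complex \<Rightarrow> 'u::ab_group_add \<Rightarrow> 'u"
  assumes surj: "range \<psi> = carrier T"
    and U: "vector_space sU" "vector_space.dim sU UNIV = c" "c > 0"
  shows "dimension c (range k) (carrier T) \<longleftrightarrow>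
    (\<exists>\<phi>. Vector_Spaces.linear sV sU \<phi> \<and> surj \<phi> \<and> {v. \<phi> v = 0} = {v. \<psi> v = \<zero>})"
    (is "?L \<longleftrightarrow> ?R")
proof -
  interpret U: vector_space sU by fact
  interpret UV: vector_space_pair sU sV ..
  interpret VU: vector_space_pair sV sU ..
  obtain bs where bs: "distinct bs" "U.independent (set bs)" "U.span (set bs) = UNIV" "length bs = c"
  proof -
    \<comment> \<open>Dimension \<open>0\<close> is also the default value for infinite dimension, so finiteness comes from \<open>c > 0\<close>.\<close>
    obtain b where b: "U.independent b" "UNIV \<subseteq> U.span b" "card b = c"
      using U.basis_exists [of UNIV] U(2) by metis
    then have "finite b" using U(3) card_ge_0_finite by blast
    then obtain bs where "set bs = b" "distinct bs" using finite_distinct_list by blast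
    with b show thesis using that [of bs] distinct_card by (metis top.extremum_uniqueI)
  qed
  show ?thesis
  proof
    assume ?L
    then obtain Us where Us: "independent (range k) Us" "length Us = c" "Span (range k) Us = carrier T"
      using dimension_imp_basis by blast
    have "\<exists>vs. Us = map \<psi> vs"
      unfolding ex_map_conv using independent_in_carrier [OF Us(1)] surj by blast
    then obtain vs where vs: "Us = map \<psi> vs" ..
    \<comment> \<open>A linear lift to \<open>V\<close> of the basis \<open>Us\<close> of \<open>T\<close>, indexed by a basis of \<open>U\<close>.\<close>
    define \<sigma> where "\<sigma> = UV.construct (set bs) (\<lambda>b. the (map_of (zip bs vs) b))"
    have lin: "Vector_Spaces.linear sU sV \<sigma>"
      unfolding \<sigma>_def by (rule UV.linear_construct) (fact bs(2))
    interpret \<sigma>: module_hom sU sV \<sigma> using lin module_hom_iff_linear by blast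
    have \<sigma>_bs: "map \<sigma> bs = vs"
      using bs Us(2) vs
      by (intro nth_equalityI) (auto simp: \<sigma>_def UV.construct_basis map_of_zip_nth)
    interpret c: semilinear_map T sU k "\<psi> \<circ> \<sigma>"
      by unfold_locales (simp_all add: k_carrier \<psi>_carrier \<psi>_add \<psi>_scale \<sigma>.add \<sigma>.scale)
    have Us_eq: "Us = map (\<psi> \<circ> \<sigma>) bs" by (simp add: vs \<sigma>_bs flip: map_map)
    have range: "range (\<psi> \<circ> \<sigma>) = carrier T"
      using c.Span_image [of bs] Us(3) bs(3) Us_eq by simp
    have inj: "inj (\<psi> \<circ> \<sigma>)"
    proof (rule injI)
      fix x y assume "(\<psi> \<circ> \<sigma>) x = (\<psi> \<circ> \<sigma>) y"
      then have "(\<psi> \<circ> \<sigma>) (x - y) = \<zero>" using c.\<psi>_eq_iff by blast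
      then have "x - y = 0"
        using c.kernel_trivial_on_span [of bs "x - y"] Us(1) bs(3) Us_eq by simp
      then show "x = y" by simp
    qed
    define \<phi> where "\<phi> v = inv_into UNIV (\<psi> \<circ> \<sigma>) (\<psi> v)" for v
    have \<phi>: "\<psi> (\<sigma> (\<phi> v)) = \<psi> v" for v
      using f_inv_into_f [of "\<psi> v" "\<psi> \<circ> \<sigma>" UNIV] range surj by (auto simp: \<phi>_def)
    have \<phi>I: "\<phi> v = u" if "\<psi> (\<sigma> u) = \<psi> v" for u v
      using inj \<phi> [of v] that by (simp add: inj_def)
    have "Vector_Spaces.linear sV sU \<phi>"
      by (auto simp: Vector_Spaces.linear_iff V.vector_space_axioms U.vector_space_axioms
          \<sigma>.add \<sigma>.scale \<psi>_add \<psi>_scale \<phi> intro!: \<phi>I)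
    moreover have "\<phi> (\<sigma> u) = u" for u by (rule \<phi>I) simp
    then have "surj \<phi>" by (rule surjI)
    moreover have "\<phi> v = 0 \<longleftrightarrow> \<psi> v = \<zero>" for v
      using \<phi> [of v] \<phi>I [of 0 v] by (auto simp: \<psi>_zero)
    ultimately show ?R by blast
  next
    assume ?R
    then obtain \<phi> where \<phi>: "Vector_Spaces.linear sV sU \<phi>" "surj \<phi>" "\<And>v. \<phi> v = 0 \<longleftrightarrow> \<psi> v = \<zero>"
      by blast
    interpret \<phi>: module_hom sV sU \<phi> using \<phi>(1) module_hom_iff_linear by blast
    obtain \<sigma> where \<sigma>: "Vector_Spaces.linear sU sV \<sigma>" "\<phi> \<circ> \<sigma> = id"
      using VU.linear_surjective_right_inverse [OF \<phi>(1,2)] by blast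
    interpret \<sigma>: module_hom sU sV \<sigma> using \<sigma>(1) module_hom_iff_linear by blast
    interpret c: semilinear_map T sU k "\<psi> \<circ> \<sigma>"
      by unfold_locales (simp_all add: k_carrier \<psi>_carrier \<psi>_add \<psi>_scale \<sigma>.add \<sigma>.scale)
    have \<phi>\<sigma>: "\<phi> (\<sigma> u) = u" for u using \<sigma>(2) by (simp add: fun_eq_iff)
    have "inj (\<psi> \<circ> \<sigma>)"
    proof (rule injI)
      fix x y assume "(\<psi> \<circ> \<sigma>) x = (\<psi> \<circ> \<sigma>) y"
      then have "\<phi> (\<sigma> (x - y)) = 0" using c.\<psi>_eq_iff \<phi>(3) by auto
      then show "x = y" by (simp add: \<phi>\<sigma>)
    qed
    then have "independent (range k) (map (\<psi> \<circ> \<sigma>) bs)"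
      using bs by (intro c.independent_image)
    moreover have "range (\<psi> \<circ> \<sigma>) = carrier T"
    proof -
      have "\<psi> v = (\<psi> \<circ> \<sigma>) (\<phi> v)" for v
      proof -
        have "\<phi> (v - \<sigma> (\<phi> v)) = 0" by (simp add: \<phi>.diff \<phi>\<sigma>)
        then show ?thesis using \<phi>(3) \<psi>_eq_iff [of v "\<sigma> (\<phi> v)"] by simp
      qed
      then have "range \<psi> \<subseteq> range (\<psi> \<circ> \<sigma>)" by blast
      then show ?thesis using surj by auto
    qed
    then have "Span (range k) (map (\<psi> \<circ> \<sigma>) bs) = carrier T"
      using c.Span_image [of bs] bs(3) by simp
    ultimately show ?L
      using dimension_independent [of "range k" "map (\<psi> \<circ> \<sigma>) bs"] bs(4) by simp
  qed
qed

end


section \<open>The presentation defined by a tuple\<close>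

text \<open>
  The vector \<open>w0\<close> identifies the line \<open>W\<close> with \<open>\<complex>\<close>, so that a linear map from \<open>W\<close> to \<open>V\<close> is a vector of
  \<open>V\<close>, its value at \<open>w0\<close>.
\<close>

locale line_and_space = V: vector_space sV + W: vector_space sW
  for sV :: "complex \<Rightarrow> 'v::ab_group_add \<Rightarrow> 'v"
    and sW :: "complex \<Rightarrow> 'w::ab_group_add \<Rightarrow> 'w" +
  fixes w0 :: 'w
  assumes w0_independent: "W.independent {w0}" and w0_span: "W.span {w0} = UNIV"
begin

sublocale WV: vector_space_pair sW sV ..

lemma linear_from_line_eqI:
  assumes "Vector_Spaces.linear sW sV I" "Vector_Spaces.linear sW sV I'" "I w0 = I' w0"
  shows "I = I'"
  using WV.linear_eq_on [OF assms(1,2), of _ "{w0}"] assms(3) w0_span by auto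

definition presentation :: "('n::finite \<Rightarrow> 'v \<Rightarrow> 'v) \<times> ('w \<Rightarrow> 'v) \<Rightarrow> 'n cpoly \<Rightarrow> 'v"
  where "presentation x f = op_eval sV f (fst x) (snd x w0)"

definition relations :: "('n::finite \<Rightarrow> 'v \<Rightarrow> 'v) \<times> ('w \<Rightarrow> 'v) \<Rightarrow> 'n cpoly set"
  where "relations x = {f. presentation x f = 0}"

lemma commuting_tuplesD:
  assumes "(B, I) \<in> commuting_tuples sV sW"
  shows "commuting_endomorphisms sV B" "Vector_Spaces.linear sW sV I"
proof -
  have "B i \<circ> B j = B j \<circ> B i" for i j
    using assms by (cases "i = j") (auto simp: commuting_tuples_def)
  then show "commuting_endomorphisms sV B"
    using assms
    by (intro commuting_endomorphisms.intro commuting_endomorphisms_axioms.intro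
        V.vector_space_axioms) (auto simp: commuting_tuples_def)
  show "Vector_Spaces.linear sW sV I"
    using assms by (simp add: commuting_tuples_def)
qed

lemma commuting_tuplesI:
  assumes "commuting_endomorphisms sV B" "Vector_Spaces.linear sW sV I"
  shows "(B, I) \<in> commuting_tuples sV sW"
  using assms
  by (simp add: commuting_tuples_def commuting_endomorphisms.linear_B commuting_endomorphisms.commute)

context
  fixes B :: "'n::finite \<Rightarrow> 'v \<Rightarrow> 'v" and I :: "'w \<Rightarrow> 'v"
  assumes tuple: "(B, I) \<in> commuting_tuples sV sW"
begin

interpretation commuting_endomorphisms sV B
  by (rule commuting_tuplesD) (fact tuple)

lemma linear_presentation: "Vector_Spaces.linear pscale sV (presentation (B, I))"
  by (auto simp: Vector_Spaces.linear_iff vector_space_pscale V.vector_space_axioms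
      presentation_def op_eval_add op_eval_pscale)

lemma presentation_mult:
  "presentation (B, I) (f * g) = op_eval sV f B (presentation (B, I) g)"
  by (simp add: presentation_def op_eval_mult)

lemma presentation_one: "presentation (B, I) 1 = I w0"
  using op_eval_const [of 1] by (simp add: presentation_def)

lemma presentation_coordinate: "presentation (B, I) (coordinate i * f) = B i (presentation (B, I) f)"
  by (simp add: presentation_mult op_eval_var)

text \<open>
  The image is a \<open>B\<close>-invariant subspace containing the range of \<open>I\<close>, and stability leaves only \<open>V\<close> itself.
\<close>

lemma presentation_surj:
  assumes "stable sV (B, I)"
  shows "surj (presentation (B, I))"
proof -
  interpret module_hom pscale sV "presentation (B, I)"
    using linear_presentation module_hom_iff_linear by blast
  interpret I: module_hom sW sV I
    using commuting_tuplesD(2) [OF tuple] module_hom_iff_linear by blast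
  let ?S = "range (presentation (B, I))"
  have "V.subspace ?S"
    by (rule subspace_image) simp
  moreover have "B i ` ?S \<subseteq> ?S" for i
    by (auto simp flip: presentation_coordinate)
  moreover have "range I \<subseteq> ?S"
  proof
    fix v assume "v \<in> range I"
    then obtain w where v: "v = I w" by blast
    have "w \<in> W.span {w0}" by (simp add: w0_span)
    then obtain a where "w = sW a w0" by (auto simp: W.span_singleton)
    then have "v = presentation (B, I) (pscale a 1)"
      by (simp add: v scale I.scale presentation_one)
    then show "v \<in> ?S" by blast
  qed
  ultimately show ?thesis
    using assms unfolding stable_def by blast
qed

text \<open>
  An invariant subspace that contains \<open>I w0\<close> contains \<open>f(B) (I w0)\<close> for every polynomial \<open>f\<close>.
\<close>

lemma surj_presentation_imp_stable:
  assumes "surj (presentation (B, I))"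
  shows "stable sV (B, I)"
proof -
  interpret p: module_hom pscale sV "presentation (B, I)"
    using linear_presentation module_hom_iff_linear by blast
  have "S = UNIV"
    if S: "V.subspace S" "\<And>i. B i ` S \<subseteq> S" "range I \<subseteq> S" for S
  proof -
    have "presentation (B, I) f \<in> S" for f
    proof (induction f rule: cpoly_induct)
      case (const a)
      have "presentation (B, I) 1 \<in> S" using S(3) presentation_one by auto
      then have "sV a (presentation (B, I) 1) \<in> S" by (rule V.subspace_scale [OF S(1)])
      then show ?case using p.scale [of a 1] by (simp add: pscale_def)
    next
      case (add f h)
      then show ?case using V.subspace_add [OF S(1)] by (simp add: p.add)
    next
      case (var i f)
      then have "B i (presentation (B, I) f) \<in> S" using S(2) by blast
      then show ?case by (simp add: presentation_coordinate)
    qed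
    then have "range (presentation (B, I)) \<subseteq> S" by blast
    then show ?thesis using assms by auto
  qed
  then show ?thesis
    unfolding stable_def by blast
qed

lemma ideal_relations: "ideal (relations (B, I)) cpoly_ring"
proof -
  interpret module_hom pscale sV "presentation (B, I)"
    using linear_presentation module_hom_iff_linear by blast
  interpret R: cring "cpoly_ring :: 'n cpoly ring"
    by (rule cring_from_type_algebra)
  have zero: "op_eval sV f B 0 = 0" for f
    using op_eval_mult [of f 0 0] linear_op_eval
    by (metis module_hom_iff_linear module_hom.zero)
  have mult: "f * g \<in> relations (B, I)" if "g \<in> relations (B, I)" for f g
    using that zero by (simp add: relations_def presentation_mult)
  show ?thesis
  proof (intro idealI R.ring_axioms)
    show "subgroup (relations (B, I)) (add_monoid cpoly_ring)"
      by (rule R.add.subgroupI)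
        (auto simp: ring_of_type_algebra_simps relations_def add neg zero simp flip: a_inv_def
          intro!: exI [of _ 0])
  qed (use mult in \<open>auto simp: ring_of_type_algebra_simps mult.commute intro: R.ring_axioms\<close>)
qed

end

lemma presentation_unique:
  assumes tuple: "(B, I) \<in> commuting_tuples sV sW" and \<phi>: "Vector_Spaces.linear pscale sV \<phi>"
    and coord: "\<And>i f. \<phi> (coordinate i * f) = B i (\<phi> f)" and one: "\<phi> 1 = I w0"
  shows "presentation (B, I) = \<phi>"
proof
  fix f
  interpret \<phi>: module_hom pscale sV \<phi> using \<phi> module_hom_iff_linear by blast
  interpret P: module_hom pscale sV "presentation (B, I)"
    using linear_presentation [OF tuple] module_hom_iff_linear by blast
  show "presentation (B, I) f = \<phi> f"
  proof (induction f rule: cpoly_induct)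
    case (const a)
    show ?case
      using P.scale [of a 1] \<phi>.scale [of a 1]
      by (simp add: pscale_def presentation_one [OF tuple] one)
  next
    case (add f g)
    then show ?case by (simp add: P.add \<phi>.add)
  next
    case (var i f)
    then show ?case by (simp add: presentation_coordinate [OF tuple] coord)
  qed
qed


section \<open>Orbits and relations\<close>

lemma GL_D:
  assumes "g \<in> carrier (GL sV)"
  shows "Vector_Spaces.linear sV sV g" "bij g"
  using assms by (simp_all add: GL_def)

lemma GL_action_commuting:
  assumes tuple: "(B, I) \<in> commuting_tuples sV sW" and g: "g \<in> carrier (GL sV)"
  shows "GL_action g (B, I) \<in> commuting_tuples sV sW"
proof -
  interpret B: commuting_endomorphisms sV B by (rule commuting_tuplesD) (fact tuple)
  interpret g: module_hom sV sV g using GL_D(1) [OF g] module_hom_iff_linear by blast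
  note inv = bij_is_inj [OF GL_D(2) [OF g]] bij_is_surj [OF GL_D(2) [OF g]]
  have inv_eq: "inv_into UNIV g v = u" if "v = g u" for u v using inv that by simp
  have "inv_into UNIV g (v + w) = inv_into UNIV g v + inv_into UNIV g w" for v w
    by (rule inv_eq) (simp add: g.add surj_f_inv_f inv)
  moreover have "inv_into UNIV g (sV a v) = sV a (inv_into UNIV g v)" for a v
    by (rule inv_eq) (simp add: g.scale surj_f_inv_f inv)
  moreover have "B i (B j v) = B j (B i v)" for i j v
    using B.commute [of i j] by (simp add: fun_eq_iff)
  ultimately have "commuting_endomorphisms sV (\<lambda>i. g \<circ> B i \<circ> inv_into UNIV g)"
    by unfold_locales
      (auto simp: Vector_Spaces.linear_iff V.vector_space_axioms B.B.add B.B.scale g.add g.scale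
        fun_eq_iff inv)
  moreover have "Vector_Spaces.linear sW sV (g \<circ> I)"
    using commuting_tuplesD(2) [OF tuple]
    by (auto simp: Vector_Spaces.linear_iff g.add g.scale)
  ultimately show ?thesis
    unfolding GL_action_def by (simp add: commuting_tuplesI)
qed

text \<open>
  By uniqueness, since \<open>g \<circ> presentation (B, I)\<close> intertwines multiplication by the coordinates with the
  conjugated endomorphisms.
\<close>

lemma presentation_GL_action:
  assumes tuple: "(B, I) \<in> commuting_tuples sV sW" and g: "g \<in> carrier (GL sV)"
  shows "presentation (GL_action g (B, I)) = g \<circ> presentation (B, I)"
proof -
  have *: "((\<lambda>i. g \<circ> B i \<circ> inv_into UNIV g), g \<circ> I) \<in> commuting_tuples sV sW"
    using GL_action_commuting [OF assms] by (simp add: GL_action_def)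
  interpret g: module_hom sV sV g using GL_D(1) [OF g] module_hom_iff_linear by blast
  interpret P: module_hom pscale sV "presentation (B, I)"
    using linear_presentation [OF tuple] module_hom_iff_linear by blast
  show ?thesis
    unfolding GL_action_def prod.case
  proof (rule presentation_unique [OF *])
    show "Vector_Spaces.linear pscale sV (g \<circ> presentation (B, I))"
      by (simp add: Vector_Spaces.linear_iff vector_space_pscale V.vector_space_axioms
          P.add P.scale g.add g.scale)
  qed (simp_all add: presentation_coordinate [OF tuple] presentation_one [OF tuple]
      bij_is_inj [OF GL_D(2) [OF g]])
qed

lemma relations_GL_action:
  assumes tuple: "x \<in> commuting_tuples sV sW" and g: "g \<in> carrier (GL sV)"
  shows "relations (GL_action g x) = relations x"
proof -
  interpret g: module_hom sV sV g using GL_D(1) [OF g] module_hom_iff_linear by blast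
  have "g v = 0 \<longleftrightarrow> v = 0" for v
    using bij_is_inj [OF GL_D(2) [OF g]] g.zero by (metis injD)
  then show ?thesis
    using presentation_GL_action [of "fst x" "snd x" g] assms by (simp add: relations_def)
qed

text \<open>
  Two quotient maps with the same kernel induce an isomorphism \<open>g\<close> of their targets, here an
  automorphism of \<open>V\<close>. It intertwines the coordinates and matches the images of \<open>1\<close>, which is all the
  data in a tuple.
\<close>

lemma same_relations_imp_GL_action:
  assumes x: "x \<in> commuting_tuples sV sW" "stable sV x"
    and x': "x' \<in> commuting_tuples sV sW" "stable sV x'"
    and eq: "relations x = relations x'"
  obtains g where "g \<in> carrier (GL sV)" "x' = GL_action g x"
proof -
  obtain B I where x_eq: "x = (B, I)" by (cases x)
  obtain B' I' where x'_eq: "x' = (B', I')" by (cases x')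
  note tuple = x(1) [unfolded x_eq] and tuple' = x'(1) [unfolded x'_eq]
  let ?p = "presentation (B, I)" and ?p' = "presentation (B', I')"
  interpret p: module_hom pscale sV ?p
    using linear_presentation [OF tuple] module_hom_iff_linear by blast
  interpret p': module_hom pscale sV ?p'
    using linear_presentation [OF tuple'] module_hom_iff_linear by blast
  have surj: "surj ?p" "surj ?p'"
    using presentation_surj [OF tuple] presentation_surj [OF tuple'] x(2) x'(2)
    by (simp_all add: x_eq x'_eq)
  have eq_iff: "?p f = ?p h \<longleftrightarrow> ?p' f = ?p' h" for f h
  proof -
    have "?p (f - h) = 0 \<longleftrightarrow> ?p' (f - h) = 0"
      using eq by (auto simp: relations_def x_eq x'_eq)
    then show ?thesis by (simp add: p.diff p'.diff)
  qed
  define g where "g v = ?p' (inv_into UNIV ?p v)" for v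
  have g: "g (?p f) = ?p' f" for f
    using eq_iff [of "inv_into UNIV ?p (?p f)" f] surj(1) by (simp add: g_def surj_f_inv_f)
  have ex: "\<exists>f. v = ?p f" for v using surj(1) by (metis surjD)
  have "g (v + w) = g v + g w" for v w
  proof -
    obtain e f where "v = ?p e" "w = ?p f" using ex by metis
    then show ?thesis by (simp add: g flip: p.add) (simp add: p'.add)
  qed
  moreover have "g (sV a v) = sV a (g v)" for a v
  proof -
    obtain f where "v = ?p f" using ex by metis
    then show ?thesis by (simp add: g flip: p.scale) (simp add: p'.scale)
  qed
  moreover have "inj g"
  proof (rule injI)
    fix v w assume *: "g v = g w"
    obtain e f where "v = ?p e" "w = ?p f" using ex by metis
    with * show "v = w" by (simp add: g eq_iff)
  qed
  moreover have "surj g"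
    by (rule surjI [of g "\<lambda>v. ?p (inv_into UNIV ?p' v)"]) (simp add: g surj_f_inv_f surj(2))
  ultimately have GL: "g \<in> carrier (GL sV)"
    by (simp add: GL_def bij_def Vector_Spaces.linear_iff V.vector_space_axioms)
  have "B' i = g \<circ> B i \<circ> inv_into UNIV g" for i
  proof
    fix v
    obtain f where v: "v = ?p' f" using surj(2) by (metis surjD)
    have "inv_into UNIV g v = ?p f" using \<open>inj g\<close> by (simp add: v flip: g)
    then show "B' i v = (g \<circ> B i \<circ> inv_into UNIV g) v"
      by (simp add: v g flip: presentation_coordinate [OF tuple] presentation_coordinate [OF tuple'])
  qed
  moreover have "I' = g \<circ> I"
  proof (rule linear_from_line_eqI)
    show "Vector_Spaces.linear sW sV I'" by (rule commuting_tuplesD) (fact tuple')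
    show "Vector_Spaces.linear sW sV (g \<circ> I)"
      using GL_action_commuting [OF tuple GL] commuting_tuplesD(2)
      unfolding GL_action_def by auto
    show "I' w0 = (g \<circ> I) w0"
      by (simp add: g flip: presentation_one [OF tuple] presentation_one [OF tuple'])
  qed
  ultimately have "x' = GL_action g x"
    by (simp add: GL_action_def x_eq x'_eq fun_eq_iff)
  with GL show thesis by (rule that)
qed

text \<open>
  When the kernel is an ideal, multiplication by the coordinates descends along the surjection to
  commuting endomorphisms of \<open>V\<close>; the vector \<open>I w0\<close> has to be the image of \<open>1\<close>.
\<close>

lemma exists_tuple_with_presentation:
  fixes \<phi> :: "'n::finite cpoly \<Rightarrow> 'v"
  assumes \<phi>: "Vector_Spaces.linear pscale sV \<phi>" "surj \<phi>"
    and ideal: "\<And>f h. \<phi> h = 0 \<Longrightarrow> \<phi> (f * h) = 0"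
  obtains B I where "(B, I) \<in> commuting_tuples sV sW" "stable sV (B, I)" "presentation (B, I) = \<phi>"
proof -
  interpret \<phi>: module_hom pscale sV \<phi> using \<phi>(1) module_hom_iff_linear by blast
  \<comment> \<open>The value does not depend on the chosen preimage, because the kernel is an ideal.\<close>
  define B :: "'n \<Rightarrow> 'v \<Rightarrow> 'v" where "B i v = \<phi> (coordinate i * inv_into UNIV \<phi> v)" for i v
  have B: "B i (\<phi> f) = \<phi> (coordinate i * f)" for i f
  proof -
    have "\<phi> (inv_into UNIV \<phi> (\<phi> f) - f) = 0" using \<phi>(2) by (simp add: \<phi>.diff surj_f_inv_f)
    from ideal [OF this, of "coordinate i"] show ?thesis
      by (simp add: B_def right_diff_distrib \<phi>.diff)
  qed
  have ex: "\<exists>f. v = \<phi> f" for v using \<phi>(2) by (metis surjD)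
  have B_add: "B i (v + w) = B i v + B i w" for i v w
  proof -
    obtain e f where "v = \<phi> e" "w = \<phi> f" using ex by metis
    then show ?thesis by (simp add: B flip: \<phi>.add) (simp add: \<phi>.add distrib_left)
  qed
  have B_scale: "B i (sV a v) = sV a (B i v)" for i a v
  proof -
    obtain f where "v = \<phi> f" using ex by metis
    then show ?thesis by (simp add: B pscale_def mult.left_commute flip: \<phi>.scale)
  qed
  have B_commute: "B i (B j v) = B j (B i v)" for i j v
  proof -
    obtain f where "v = \<phi> f" using ex by metis
    then show ?thesis by (simp add: B mult.left_commute)
  qed
  have B_tuple: "commuting_endomorphisms sV B"
    by unfold_locales
      (auto simp: Vector_Spaces.linear_iff V.vector_space_axioms B_add B_scale B_commute fun_eq_iff)
  define I where "I = WV.construct {w0} (\<lambda>_. \<phi> 1)"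
  have I: "Vector_Spaces.linear sW sV I" "I w0 = \<phi> 1"
    using w0_independent by (simp_all add: I_def WV.linear_construct WV.construct_basis)
  have tuple: "(B, I) \<in> commuting_tuples sV sW"
    by (rule commuting_tuplesI) (fact B_tuple I)+
  have pres: "presentation (B, I) = \<phi>"
    by (rule presentation_unique) (fact tuple \<phi>(1) | simp add: B I)+
  then have "stable sV (B, I)"
    using \<phi>(2) by (intro surj_presentation_imp_stable [OF tuple]) simp
  then show thesis using that tuple pres by blast
qed

text \<open>
  For the nontrivial direction: \<open>f(B)\<close> vanishes at \<open>I w0\<close>, hence at every \<open>h(B) (I w0)\<close>, because
  the relations form an ideal; stability says that these vectors fill \<open>V\<close>.
\<close>

lemma stable_tuples_on_iff:
  "x \<in> stable_tuples_on sV sW Z \<longleftrightarrow>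
    x \<in> commuting_tuples sV sW \<and> stable sV x \<and> Z \<subseteq> relations x"
proof (cases x)
  case (Pair B I)
  have "(\<forall>f\<in>Z. op_eval sV f B = (\<lambda>v. 0)) \<longleftrightarrow> Z \<subseteq> relations (B, I)"
    if tuple: "(B, I) \<in> commuting_tuples sV sW" and st: "stable sV (B, I)"
  proof
    assume "\<forall>f\<in>Z. op_eval sV f B = (\<lambda>v. 0)"
    then show "Z \<subseteq> relations (B, I)"
      by (auto simp: relations_def presentation_def)
  next
    interpret ideal "relations (B, I)" cpoly_ring by (rule ideal_relations) (fact tuple)
    assume Z: "Z \<subseteq> relations (B, I)"
    show "\<forall>f\<in>Z. op_eval sV f B = (\<lambda>v. 0)"
    proof (intro ballI ext)
      fix f v
      assume "f \<in> Z"
      then have f: "f * h \<in> relations (B, I)" for h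
        using I_r_closed [of f h] Z by (auto simp: ring_of_type_algebra_simps)
      obtain h where "v = presentation (B, I) h"
        using presentation_surj [OF tuple st] by (metis surjD)
      with f [of h] show "op_eval sV f B v = 0"
        by (simp add: relations_def presentation_mult [OF tuple])
    qed
  qed
  then show ?thesis
    by (auto simp: stable_tuples_on_def Pair)
qed

definition ideals_presented_by_V :: "'n::finite cpoly set \<Rightarrow> 'n cpoly set set"
  where "ideals_presented_by_V Z = {N. ideal N cpoly_ring \<and> Z \<subseteq> N \<and>
    (\<exists>\<phi>. Vector_Spaces.linear pscale sV \<phi> \<and> surj \<phi> \<and> {f. \<phi> f = 0} = N)}"

lemma relations_image:
  fixes Z :: "'n::finite cpoly set"
  shows "relations ` stable_tuples_on sV sW Z = ideals_presented_by_V Z"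
proof (intro equalityI subsetI)
  fix N assume "N \<in> relations ` stable_tuples_on sV sW Z"
  then obtain B I where tuple: "(B, I) \<in> commuting_tuples sV sW" and st: "stable sV (B, I)"
    and N: "Z \<subseteq> relations (B, I)" "N = relations (B, I)"
    by (force simp: stable_tuples_on_iff)
  show "N \<in> ideals_presented_by_V Z"
    using ideal_relations [OF tuple] N linear_presentation [OF tuple] presentation_surj [OF tuple st]
    unfolding ideals_presented_by_V_def relations_def by blast
next
  fix N assume "N \<in> ideals_presented_by_V Z"
  then obtain \<phi> where N: "ideal N cpoly_ring" "Z \<subseteq> N"
    and \<phi>: "Vector_Spaces.linear pscale sV \<phi>" "surj \<phi>" "{f. \<phi> f = 0} = N"
    unfolding ideals_presented_by_V_def by blast
  interpret N: ideal N cpoly_ring by (fact N(1))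
  have "\<phi> (f * h) = 0" if "\<phi> h = 0" for f h
    using N.I_l_closed [of h f] \<phi>(3) that by (auto simp: ring_of_type_algebra_simps)
  then obtain B I where x: "(B, I) \<in> commuting_tuples sV sW" "stable sV (B, I)"
      "presentation (B, I) = \<phi>"
    using exists_tuple_with_presentation [OF \<phi>(1,2)] by metis
  then have "relations (B, I) = N" using \<phi>(3) by (simp add: relations_def)
  with x N(2) show "N \<in> relations ` stable_tuples_on sV sW Z"
    by (auto simp: stable_tuples_on_iff intro!: image_eqI [of _ _ "(B, I)"])
qed

lemma orbit_eq_fibre:
  assumes "x \<in> stable_tuples_on sV sW Z"
  shows "orbit (GL sV) GL_action x =
    {y \<in> stable_tuples_on sV sW Z. relations y = relations x}"
proof (intro equalityI subsetI)
  fix y assume "y \<in> {y \<in> stable_tuples_on sV sW Z. relations y = relations x}"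
  then obtain g where "g \<in> carrier (GL sV)" "y = GL_action g x"
    using assms same_relations_imp_GL_action [of x y] by (auto simp: stable_tuples_on_iff)
  then show "y \<in> orbit (GL sV) GL_action x"
    by (auto simp: orbit_def)
next
  fix y assume "y \<in> orbit (GL sV) GL_action x"
  then obtain g where g: "g \<in> carrier (GL sV)" "y = GL_action g x"
    by (auto simp: orbit_def)
  obtain B I where x: "x = (B, I)" by (cases x)
  obtain B' I' where y: "y = (B', I')" by (cases y)
  have tuple: "(B, I) \<in> commuting_tuples sV sW" and st: "stable sV (B, I)" "Z \<subseteq> relations (B, I)"
    using assms by (simp_all add: x stable_tuples_on_iff)
  have tuple': "(B', I') \<in> commuting_tuples sV sW"
    using GL_action_commuting [OF tuple g(1)] g(2) by (simp add: x y)
  have rel: "relations y = relations x"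
    using relations_GL_action [OF tuple g(1)] g(2) by (simp add: x)
  have "presentation (B', I') = g \<circ> presentation (B, I)"
    using presentation_GL_action [OF tuple g(1)] g(2) by (simp add: x y)
  then have "surj (presentation (B', I'))"
    using comp_surj [OF presentation_surj [OF tuple st(1)] bij_is_surj [OF GL_D(2) [OF g(1)]]]
    by (simp only:)
  then have "stable sV (B', I')" by (rule surj_presentation_imp_stable [OF tuple'])
  with tuple' st(2) rel show "y \<in> {y \<in> stable_tuples_on sV sW Z. relations y = relations x}"
    by (simp add: x y stable_tuples_on_iff)
qed

text \<open>
  The orbits are the fibres of \<open>relations\<close>. The image of an orbit is therefore a singleton, whose
  element is the ideal assigned to the orbit.
\<close>

theorem bij_betw_moduli_space_ideals:
  fixes Z :: "'n::finite cpoly set"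
  shows "bij_betw (\<lambda>orb. the_elem (relations ` orb)) (moduli_space sV sW Z) (ideals_presented_by_V Z)"
proof -
  let ?S = "stable_tuples_on sV sW Z :: (('n \<Rightarrow> 'v \<Rightarrow> 'v) \<times> ('w \<Rightarrow> 'v)) set"
  let ?F = "\<lambda>x. {y \<in> ?S. relations y = relations x}"
  have "moduli_space sV sW Z = orbit (GL sV) GL_action ` ?S"
    by (auto simp: moduli_space_def orbits_def)
  also have "\<dots> = ?F ` ?S"
    by (rule image_cong) (simp_all add: orbit_eq_fibre)
  finally have moduli: "moduli_space sV sW Z = ?F ` ?S" .
  have the: "the_elem (relations ` ?F x) = relations x" if "x \<in> ?S" for x
  proof -
    have "relations ` ?F x = {relations x}" using that by auto
    then show ?thesis by simp
  qed
  show ?thesis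
    unfolding bij_betw_def moduli relations_image [symmetric]
  proof (intro conjI inj_onI)
    fix O\<^sub>1 O\<^sub>2 assume "O\<^sub>1 \<in> ?F ` ?S" "O\<^sub>2 \<in> ?F ` ?S"
      and eq: "the_elem (relations ` O\<^sub>1) = the_elem (relations ` O\<^sub>2)"
    then obtain x y where xy: "x \<in> ?S" "y \<in> ?S" "O\<^sub>1 = ?F x" "O\<^sub>2 = ?F y"
      by (elim imageE)
    with eq have "relations x = relations y"
      by (simp only: the)
    with xy show "O\<^sub>1 = O\<^sub>2" by simp
  next
    have "(\<lambda>orb. the_elem (relations ` orb)) ` ?F ` ?S = (\<lambda>x. the_elem (relations ` ?F x)) ` ?S"
      by (simp only: image_image)
    also have "\<dots> = relations ` ?S"
      by (rule image_cong) (simp_all only: the)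
    finally show "(\<lambda>orb. the_elem (relations ` orb)) ` ?F ` ?S = relations ` ?S" .
  qed
qed

end


section \<open>Ideals of the coordinate ring\<close>

text \<open>
  The composite \<open>\<pi>\<close> of the two quotient maps is a ring homomorphism onto \<open>A(Y)/J\<close> with kernel \<open>N\<close>, and it maps
  the constant polynomials onto the scalars over which the dimension is taken.
\<close>

lemma dimension_coord_ring_quotient_iff:
  fixes Z N :: "'n::finite cpoly set"
  assumes Z: "ideal Z cpoly_ring" and N: "ideal N cpoly_ring" "Z \<subseteq> N"
    and V: "vector_space sV" "vector_space.dim sV UNIV = c" "c > 0"
  defines "J \<equiv> (+>\<^bsub>cpoly_ring\<^esub>) Z ` N"
  shows "ring.dimension (coord_ring Z Quot J) c (quot_constants Z J) (carrier (coord_ring Z Quot J))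
    \<longleftrightarrow> (\<exists>\<phi>. Vector_Spaces.linear pscale sV \<phi> \<and> surj \<phi> \<and> {f. \<phi> f = 0} = N)"
proof -
  let ?A = "coord_ring Z" and ?T = "coord_ring Z Quot J"
  interpret R: cring "cpoly_ring :: 'n cpoly ring" by (rule cring_from_type_algebra)
  interpret Z: ideal Z cpoly_ring by (fact Z)
  interpret J: ideal J ?A
    unfolding coord_ring_def J_def by (rule R.ring_ideal_imp_quot_ideal) (fact Z N(1))+
  define \<pi> where "\<pi> f = J +>\<^bsub>?A\<^esub> (Z +>\<^bsub>cpoly_ring\<^esub> f)" for f
  have hom: "\<pi> \<in> ring_hom cpoly_ring ?T"
    using ring_hom_trans [OF Z.rcos_ring_hom J.rcos_ring_hom [unfolded coord_ring_def]]
    unfolding \<pi>_def coord_ring_def by (simp add: comp_def)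
  interpret T: ring ?T by (rule J.quotient_is_ring)
  interpret semilinear_map ?T pscale "\<lambda>a. \<pi> (Poly_Mapping.single 0 a)" \<pi>
    by (intro semilinear_map.intro semilinear_map_axioms.intro T.ring_axioms vector_space_pscale)
      (use ring_hom_closed [OF hom] ring_hom_add [OF hom] ring_hom_mult [OF hom] in
        \<open>simp_all add: ring_of_type_algebra_simps pscale_def\<close>)
  have range: "range \<pi> = carrier ?T"
    by (auto simp: \<pi>_def FactRing_def A_RCOSETS_def' coord_ring_def ring_of_type_algebra_simps)
  have "f \<in> N \<longleftrightarrow> \<pi> f = \<zero>\<^bsub>?T\<^esub>" for f
  proof -
    have Zf: "Z +>\<^bsub>cpoly_ring\<^esub> f \<in> carrier ?A"
      by (auto simp: FactRing_def A_RCOSETS_def' coord_ring_def ring_of_type_algebra_simps)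
    have "\<Union> J = N"
      using R.ideal_incl_iff [OF Z N(1)] N(2) unfolding J_def by simp
    then have "f \<in> N \<longleftrightarrow> Z +>\<^bsub>cpoly_ring\<^esub> f \<in> J"
      using R.canonical_proj_vimage_mem_iff [OF Z J.a_subset [unfolded coord_ring_def], of f]
      by (simp add: ring_of_type_algebra_simps)
    also have "\<dots> \<longleftrightarrow> \<pi> f = J"
      using Zf J.a_rcos_const J.rcos_const_imp_mem unfolding \<pi>_def by blast
    finally show ?thesis by (simp add: FactRing_def)
  qed
  then have "{f. \<pi> f = \<zero>\<^bsub>?T\<^esub>} = N" by blast
  moreover have "quot_constants Z J = range (\<lambda>a. \<pi> (Poly_Mapping.single 0 a))"
    by (simp add: quot_constants_def \<pi>_def)
  ultimately show ?thesis
    using dimension_iff_linear_surjection [OF range V] by simp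
qed

theorem theorem5p1:
  fixes c :: nat
    and Z :: "'n::finite cpoly set"
    and Y :: "(complex ^ 'n) set"
    and sV :: "complex \<Rightarrow> 'v::ab_group_add \<Rightarrow> 'v"
    and sW :: "complex \<Rightarrow> 'w::ab_group_add \<Rightarrow> 'w"
  assumes "c > 0"
    and "ideal Z cpoly_ring" and "Z \<subset> carrier cpoly_ring"
    and "Y = zero_locus Z"
    and "vector_space sV" and "vector_space.dim sV UNIV = c"
    and "vector_space sW" and "vector_space.dim sW UNIV = 1"
  shows "\<exists>\<Phi>. bij_betw \<Phi> (moduli_space sV sW Z) (Hilb c Z)"
proof -
  interpret V: vector_space sV by fact
  interpret W: vector_space sW by fact
  interpret R: cring "cpoly_ring :: 'n cpoly ring" by (rule cring_from_type_algebra)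
  \<comment> \<open>A basis of the line consists of one vector, which serves as \<open>w0\<close>.\<close>
  obtain b where b: "W.independent b" "UNIV \<subseteq> W.span b" "card b = 1"
    using W.basis_exists [of UNIV] assms(8) by metis
  then obtain w0 where "b = {w0}" by (auto simp: card_1_singleton_iff)
  with b interpret line_and_space sV sW w0
    by unfold_locales auto
  let ?C = "\<lambda>N. (+>\<^bsub>cpoly_ring\<^esub>) Z ` N"
  have corr: "bij_betw ?C {N. ideal N cpoly_ring \<and> Z \<subseteq> N} {J. ideal J (coord_ring Z)}"
    unfolding coord_ring_def by (rule R.quot_ideal_correspondence) fact
  have "?C ` ideals_presented_by_V Z = Hilb c Z"
  proof -
    have "N \<in> ideals_presented_by_V Z \<longleftrightarrow> ?C N \<in> Hilb c Z"
      if "N \<in> {N. ideal N cpoly_ring \<and> Z \<subseteq> N}" for N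
    proof -
      from that have N: "ideal N cpoly_ring" "Z \<subseteq> N" by simp_all
      have "ideal (?C N) (coord_ring Z)" using bij_betwE [OF corr] that by blast
      then show ?thesis
        using N dimension_coord_ring_quotient_iff [OF assms(2) N assms(5,6,1)]
        unfolding ideals_presented_by_V_def Hilb_def by simp
    qed
    moreover have "ideals_presented_by_V Z \<subseteq> {N. ideal N cpoly_ring \<and> Z \<subseteq> N}"
      unfolding ideals_presented_by_V_def by blast
    moreover have "Hilb c Z \<subseteq> ?C ` {N. ideal N cpoly_ring \<and> Z \<subseteq> N}"
      unfolding bij_betw_imp_surj_on [OF corr] Hilb_def by blast
    ultimately show ?thesis by (intro equalityI subsetI) (auto 0 3)
  qed
  moreover have "ideals_presented_by_V Z \<subseteq> {N. ideal N cpoly_ring \<and> Z \<subseteq> N}"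
    unfolding ideals_presented_by_V_def by blast
  ultimately have "bij_betw ?C (ideals_presented_by_V Z) (Hilb c Z)"
    by (intro bij_betw_subset [OF corr])
  then show ?thesis
    using bij_betw_trans [OF bij_betw_moduli_space_ideals] by (intro exI)
qed

end
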